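(* For every prime power $q$, $$B(2,q)\ \ge\ q^2-\mathrm{Nikodym}(2,q).$$
   Context: $\mathrm{PG}(2,q)$ is the projective plane over $\mathbb{F}_q$. A set of points $B\subset\mathrm{PG}(2,q)$ is a blocking set if $\ell\cap B\ne\emptyset$ for every line $\ell$ of $\mathrm{PG}(2,q)$; it is a minimal blocking set if it is a blocking set and no proper subset of $B$ is a blocking set. $B(2,q)$ denotes the maximum cardinality of a minimal blocking set in $\mathrm{PG}(2,q)$. A set $N\subset\mathbb{F}_q^2$ is a Nikodym set if for every $x\in\mathbb{F}_q^2$ there exists $v\in\mathbb{F}_q^2\setminus\{0\}$ such that $\{x+tv: t\in\mathbb{F}_q\}\setminus\{x\}\subset N$. $\mathrm{Nikodym}(2,q)$ denotes the size of the smallest Nikodym set in $\mathbb{F}_q^2$. *)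

theory Defs
  imports "HOL-Analysis.Cartesian_Space" "HOL-Number_Theory.Prime_Powers"
begin

text \<open>
  The field with \<open>q\<close> elements is a type \<open>'a :: {field, finite}\<close> with \<open>CARD('a) = q\<close>.
  A point of the projective plane is a one-dimensional subspace of \<open>'a ^ 3\<close>, and a line is the set
  of all points lying in a fixed two-dimensional subspace.
\<close>

definition pg2_points :: "('a::field ^ 3) set set" where
  "pg2_points = {P. vec.subspace P \<and> vec.dim P = 1}"

definition pg2_lines :: "('a::field ^ 3) set set set" where
  "pg2_lines = {{P \<in> pg2_points. P \<subseteq> W} | W. vec.subspace W \<and> vec.dim W = 2}"

definition blocking_set :: "('a::field ^ 3) set set \<Rightarrow> bool" where
  "blocking_set B \<longleftrightarrow> B \<subseteq> pg2_points \<and> (\<forall>l\<in>pg2_lines. l \<inter> B \<noteq> {})"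

definition minimal_blocking_set :: "('a::field ^ 3) set set \<Rightarrow> bool" where
  "minimal_blocking_set B \<longleftrightarrow> blocking_set B \<and> (\<forall>C. C \<subset> B \<longrightarrow> \<not> blocking_set C)"

text \<open>
  The two extremal numbers depend only on the field, which is passed as \<open>TYPE('a)\<close>. The maximum
  and minimum range over finite nonempty sets: the set of all points is a blocking set and so
  contains a minimal one, and the whole affine plane is a Nikodym set.
\<close>

definition max_minimal_blocking :: "'a::{field,finite} itself \<Rightarrow> nat" where
  "max_minimal_blocking _ = Max (card ` {B :: ('a ^ 3) set set. minimal_blocking_set B})"

definition nikodym_set :: "('a::field ^ 2) set \<Rightarrow> bool" where
  "nikodym_set N \<longleftrightarrow> (\<forall>x. \<exists>v. v \<noteq> 0 \<and> {x + t *s v | t. True} - {x} \<subseteq> N)"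

definition nikodym_number :: "'a::{field,finite} itself \<Rightarrow> nat" where
  "nikodym_number _ = Min (card ` {N :: ('a ^ 2) set. nikodym_set N})"

end

theory Submission imports Defs begin

text \<open>
  The argument is dual. Let \<open>M\<close> be the complement of a Nikodym set \<open>N\<close>, and choose for every affine
  point \<open>x\<close> a line \<open>L x\<close> through \<open>x\<close> with \<open>L x - {x} \<subseteq> N\<close>. Together with the line at infinity, the
  lines \<open>L x\<close> cover the projective plane. A point \<open>x\<close> of \<open>M\<close> lies on \<open>L x\<close> and on none of the other
  lines, so every minimal subcover contains the lines \<open>L x\<close> with \<open>x \<in> M\<close>, and these are
  pairwise distinct. Reading lines as points through the standard bilinear form turns a minimal
  cover by lines into a minimal blocking set.
\<close>

definition dot3 :: "'a::field ^ 3 \<Rightarrow> 'a ^ 3 \<Rightarrow> 'a" where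
  "dot3 u w = u $ 1 * w $ 1 + u $ 2 * w $ 2 + u $ 3 * w $ 3"

definition affine_point :: "'a::field ^ 2 \<Rightarrow> 'a ^ 3" where
  "affine_point x = vector [x $ 1, x $ 2, 1]"

text \<open>The cross product of \<open>(v, 0)\<close> and \<open>(x, 1)\<close>: the line joining
  the affine point \<open>x\<close> to the point at infinity in direction \<open>v\<close>.\<close>

definition line_coords :: "'a::field ^ 2 \<Rightarrow> 'a ^ 2 \<Rightarrow> 'a ^ 3" where
  "line_coords x v = vector [v $ 2, - (v $ 1), v $ 1 * x $ 2 - v $ 2 * x $ 1]"

lemma dot3_subspace: "vec.subspace {u. dot3 u w = 0}"
proof (rule vec.subspaceI)
  fix c :: 'a and u
  assume "u \<in> {u. dot3 u w = 0}"
  moreover have "dot3 (c *s u) w = c * dot3 u w"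
    by (simp add: dot3_def algebra_simps)
  ultimately show "c *s u \<in> {u. dot3 u w = 0}"
    by simp
next
  fix u u'
  assume "u \<in> {u. dot3 u w = 0}" "u' \<in> {u. dot3 u w = 0}"
  moreover have "dot3 (u + u') w = dot3 u w + dot3 u' w"
    by (simp add: dot3_def algebra_simps)
  ultimately show "u + u' \<in> {u. dot3 u w = 0}"
    by simp
qed (simp add: dot3_def)

lemma span_in_pg2_points:
  assumes "u \<noteq> 0"
  shows "vec.span {u} \<in> pg2_points"
proof -
  have "vec.independent {u}"
    using assms by (simp add: vec.dependent_single)
  then have "vec.dim {u} = card {u}"
    by (rule vec.dim_eq_card_independent)
  then show ?thesis
    by (simp add: pg2_points_def)
qed

lemma line_coords_nonzero:
  assumes "v \<noteq> 0"
  shows "line_coords x v \<noteq> 0"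
  using assms by (auto simp: line_coords_def vec_eq_iff forall_2 forall_3)

text \<open>The pairing expands to the determinant of \<open>x - y\<close> and \<open>v\<close>; as
  \<open>v\<close> is nonzero, it vanishes exactly when \<open>x - y\<close> is a multiple of
  \<open>v\<close>.\<close>

lemma dot3_line_coords_eq_0_iff:
  assumes "v \<noteq> 0"
  shows "dot3 (line_coords y v) (affine_point x) = 0 \<longleftrightarrow> (\<exists>t. x = y + t *s v)"
proof
  assume "dot3 (line_coords y v) (affine_point x) = 0"
  then have eq: "v $ 2 * (x $ 1 - y $ 1) = v $ 1 * (x $ 2 - y $ 2)"
    by (simp add: dot3_def line_coords_def affine_point_def algebra_simps)
  show "\<exists>t. x = y + t *s v"
  proof (cases "v $ 1 = 0")
    case True
    then have "v $ 2 \<noteq> 0"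
      using assms by (auto simp: vec_eq_iff forall_2)
    then have "x = y + ((x $ 2 - y $ 2) / v $ 2) *s v"
      using eq True by (simp add: vec_eq_iff forall_2)
    then show ?thesis ..
  next
    case False
    then have "x = y + ((x $ 1 - y $ 1) / v $ 1) *s v"
      using eq by (simp add: vec_eq_iff forall_2 field_simps)
    then show ?thesis ..
  qed
next
  assume "\<exists>t. x = y + t *s v"
  then show "dot3 (line_coords y v) (affine_point x) = 0"
    by (auto simp: dot3_def line_coords_def affine_point_def algebra_simps)
qed

text \<open>Fix \<open>c\<close> outside \<open>W\<close>. Modulo \<open>W\<close> every vector is a
  multiple of \<open>c\<close>, and the multiplier is a linear functional; \<open>w\<close> is its
  coefficient vector.\<close>

lemma plane_normal:
  fixes W :: "('a::field ^ 3) set"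
  assumes W: "vec.subspace W" and dim: "vec.dim W = 2"
  obtains w where "w \<noteq> 0" "{u. dot3 u w = 0} \<subseteq> W"
proof -
  have "W \<noteq> UNIV"
    using dim by (auto simp: card_cart_basis)
  then obtain c where c: "c \<notin> W"
    by auto
  have spanW: "vec.span W = W"
    using W by (simp add: vec.span_eq_iff)
  have "vec.dim (insert c W) = 3"
    using c dim by (simp add: vec.dim_insert spanW)
  then have full: "vec.span (insert c W) = UNIV"
    using vec.dim_eq_full[of "insert c W"] by (simp add: vec.dimension_def card_cart_basis)
  have "\<exists>k. u - k *s c \<in> W" for u
    using vec.span_breakdown_eq[of u c W] full spanW by auto
  then obtain k where k: "\<And>u. u - k u *s c \<in> W"
    by metis
  \<comment> \<open>\<open>k\<close> comes from a choice and is not known to be linear, so only its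
    values at the unit vectors are kept and extended linearly by \<open>dot3\<close>.\<close>
  let ?w = "(\<chi> i. k (axis i 1)) :: 'a ^ 3"
  have decomp: "u - dot3 u ?w *s c \<in> W" for u
  proof -
    have "u - dot3 u ?w *s c = (\<Sum>i\<in>UNIV. u $ i *s (axis i 1 - k (axis i 1) *s c))"
      by (simp add: vec_eq_iff forall_3 sum_3 dot3_def axis_def algebra_simps)
    also have "\<dots> \<in> W"
      by (intro vec.subspace_sum vec.subspace_scale W k)
    finally show ?thesis .
  qed
  show thesis
  proof
    show "?w \<noteq> 0"
    proof
      assume "?w = 0"
      then have "dot3 c ?w = 0"
        by (simp only: dot3_def) simp
      then show False
        using decomp[of c] c by simp
    qed
    show "{u. dot3 u ?w = 0} \<subseteq> W"
    proof
      fix u assume "u \<in> {u. dot3 u ?w = 0}"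
      then show "u \<in> W"
        using decomp[of u] by simp
    qed
  qed
qed

text \<open>Dually this is the pencil of lines through \<open>x\<close>. Since it is a line, every
  blocking set contains the dual of some line through \<open>x\<close>.\<close>

lemma affine_point_dual_line:
  "{P \<in> pg2_points. P \<subseteq> {u. dot3 u (affine_point x) = 0}} \<in> pg2_lines"
proof -
  \<comment> \<open>Solving the equation for the third coordinate leaves the first two free;
    \<open>?a\<close> and \<open>?b\<close> are the corresponding basis solutions.\<close>
  let ?a = "vector [1, 0, - (x $ 1)] :: 'a ^ 3"
  let ?b = "vector [0, 1, - (x $ 2)] :: 'a ^ 3"
  let ?W = "{u. dot3 u (affine_point x) = 0}"
  have W: "vec.subspace ?W"
    by (rule dot3_subspace)
  have ne: "?a \<noteq> ?b"
    by (simp add: vec_eq_iff forall_3)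
  have "?b \<noteq> 0"
    by (simp add: vec_eq_iff forall_3)
  moreover have "?a \<notin> vec.span {?b}"
    by (auto simp: vec.span_singleton vec_eq_iff forall_3)
  ultimately have ind: "vec.independent {?a, ?b}"
    using ne by (simp add: vec.independent_insert vec.dependent_single)
  have "?W \<subseteq> vec.span {?a, ?b}"
  proof
    fix u assume "u \<in> ?W"
    then have "u $ 3 = - (u $ 1 * x $ 1) - u $ 2 * x $ 2"
      by (simp add: dot3_def affine_point_def eq_neg_iff_add_eq_0 algebra_simps)
    then have "u = u $ 1 *s ?a + u $ 2 *s ?b"
      by (simp add: vec_eq_iff forall_3)
    also have "\<dots> \<in> vec.span {?a, ?b}"
      by (intro vec.span_add vec.span_scale vec.span_base) auto
    finally show "u \<in> vec.span {?a, ?b}" .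
  qed
  moreover have "{?a, ?b} \<subseteq> ?W"
    by (simp add: dot3_def affine_point_def)
  ultimately have "vec.dim ?W = card {?a, ?b}"
    using ind by (metis vec.dim_unique)
  then have "vec.dim ?W = 2"
    using ne by simp
  with W show ?thesis
    unfolding pg2_lines_def by blast
qed

lemma blocking_set_contains_minimal:
  assumes "finite B" "blocking_set B"
  obtains C where "C \<subseteq> B" "minimal_blocking_set C"
proof -
  have "finite {C. C \<subseteq> B \<and> blocking_set C}"
    using assms(1) by simp
  moreover have "B \<in> {C. C \<subseteq> B \<and> blocking_set C}"
    using assms(2) by simp
  ultimately obtain C where "C \<in> {C. C \<subseteq> B \<and> blocking_set C}"
    and "\<forall>D\<in>{C. C \<subseteq> B \<and> blocking_set C}. D \<subseteq> C \<longrightarrow> C = D"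
    using finite_has_minimal2 by (metis (no_types, lifting))
  then have "C \<subseteq> B" "minimal_blocking_set C"
    unfolding minimal_blocking_set_def by blast+
  then show thesis
    by (rule that)
qed

lemma nikodym_complement_le_minimal_blocking_set:
  fixes N :: "('a::{field,finite} ^ 2) set"
  assumes "nikodym_set N"
  obtains C :: "('a ^ 3) set set" where "minimal_blocking_set C" "card (- N) \<le> card C"
proof -
  obtain v where v0: "\<And>x. v x \<noteq> 0"
    and vN: "\<And>x. {x + t *s v x | t. True} - {x} \<subseteq> N"
    using assms unfolding nikodym_set_def by metis
  \<comment> \<open>\<open>p x\<close> is the dual point of the line \<open>L x\<close>,
    \<open>W x\<close> the dual line of the point \<open>x\<close>, and \<open>e\<close> spans the
    dual of the line at infinity. Thus \<open>p y \<subseteq> W x\<close> says that \<open>x\<close>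
    lies on \<open>L y\<close>.\<close>
  define p where "p x = vec.span {line_coords x (v x)}" for x
  define W where "W x = {u. dot3 u (affine_point x) = 0}" for x :: "'a ^ 2"
  define e :: "'a ^ 3" where "e = vector [0, 0, 1]"
  define B where "B = insert (vec.span {e}) (range p)"
  have e0: "e \<noteq> 0"
    by (simp add: e_def vec_eq_iff forall_3)
  have pW: "p y \<subseteq> W x \<longleftrightarrow> dot3 (line_coords y (v y)) (affine_point x) = 0" for x y
    unfolding p_def W_def
    using vec.span_minimal[OF _ dot3_subspace] vec.span_base by blast
  \<comment> \<open>Every point of \<open>L y\<close> other than \<open>y\<close> is in
    \<open>N\<close>.\<close>
  have incident: "x = y" if "x \<notin> N" "p y \<subseteq> W x" for x y
    using that vN[of y] dot3_line_coords_eq_0_iff[OF v0] unfolding pW by blast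
  have incident_refl: "p x \<subseteq> W x" for x
    using dot3_line_coords_eq_0_iff[OF v0, of x x x] unfolding pW
    by (metis add.right_neutral vec.scale_zero_left)
  have not_e: "\<not> vec.span {e} \<subseteq> W x" for x
  proof
    assume "vec.span {e} \<subseteq> W x"
    then have "e \<in> W x"
      using vec.span_base by blast
    then show False
      by (simp add: W_def e_def dot3_def affine_point_def)
  qed
  have pts: "B \<subseteq> pg2_points"
    unfolding B_def p_def
    using span_in_pg2_points e0 line_coords_nonzero[OF v0] by blast
  have "blocking_set B"
    unfolding blocking_set_def
  proof (intro conjI ballI pts)
    fix l :: "('a ^ 3) set set"
    assume "l \<in> pg2_lines"
    then obtain V where l: "l = {P \<in> pg2_points. P \<subseteq> V}" and V: "vec.subspace V" "vec.dim V = 2"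
      unfolding pg2_lines_def by blast
    obtain w where w0: "w \<noteq> 0" and wV: "{u. dot3 u w = 0} \<subseteq> V"
      using plane_normal[OF V] .
    \<comment> \<open>The normal \<open>w\<close> is a point of the original plane: either it is at
      infinity, or it rescales to an affine point \<open>x\<close>, which \<open>L x\<close>
      covers.\<close>
    have "\<exists>P\<in>B. P \<subseteq> V"
    proof (cases "w $ 3 = 0")
      case True
      then have "e \<in> V"
        using wV by (auto simp: e_def dot3_def)
      then show ?thesis
        using vec.span_minimal[of "{e}" V] V(1) by (auto simp: B_def)
    next
      case False
      define x :: "'a ^ 2" where "x = vector [w $ 1 / w $ 3, w $ 2 / w $ 3]"
      have "dot3 u (affine_point x) = dot3 u w / w $ 3" for u
        using False by (simp add: x_def dot3_def affine_point_def field_simps)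
      then have "W x \<subseteq> V"
        using wV False by (auto simp: W_def)
      then show ?thesis
        unfolding B_def using incident_refl[of x] by blast
    qed
    then show "l \<inter> B \<noteq> {}"
      using pts l by blast
  qed
  moreover have "finite B"
    by simp
  ultimately obtain C where CB: "C \<subseteq> B" and C: "minimal_blocking_set C"
    using blocking_set_contains_minimal by blast
  \<comment> \<open>By \<open>incident\<close> and \<open>not_e\<close>, \<open>p x\<close> is the
    only point of \<open>B\<close> on the dual line \<open>W x\<close>, so \<open>C\<close> cannot
    omit it.\<close>
  have "p x \<in> C" if x: "x \<notin> N" for x
  proof -
    have "{P \<in> pg2_points. P \<subseteq> W x} \<inter> C \<noteq> {}"
      using C affine_point_dual_line
      unfolding minimal_blocking_set_def blocking_set_def W_def by blast
    then obtain P where P: "P \<in> C" "P \<subseteq> W x"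
      by blast
    then obtain y where "P = p y"
      using CB not_e unfolding B_def by blast
    then show ?thesis
      using P incident x by blast
  qed
  then have "p ` (- N) \<subseteq> C"
    by blast
  \<comment> \<open>If \<open>p x = p y\<close>, then \<open>x\<close> lies on \<open>L y\<close>,
    and \<open>incident\<close> applies.\<close>
  moreover have "inj_on p (- N)"
  proof (rule inj_onI)
    fix x y assume "x \<in> - N" "p x = p y"
    then show "x = y"
      using incident[of x y] incident_refl[of x] by simp
  qed
  ultimately have "card (- N) \<le> card C"
    by (metis card_image card_mono finite)
  with C show thesis
    by (rule that)
qed

theorem proposition1p12:
  fixes q :: nat
  assumes "primepow q"
    and "CARD('a::{field,finite}) = q"
  shows "int (max_minimal_blocking TYPE('a)) \<ge> int (q ^ 2) - int (nikodym_number TYPE('a))"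
proof -
  \<comment> \<open>Any nonzero direction shows that the whole plane is a Nikodym set, so the
    minimum is attained by some \<open>N\<close>.\<close>
  have "(1 :: 'a ^ 2) \<noteq> 0"
    by (simp add: vec_eq_iff)
  then have "nikodym_set (UNIV :: ('a ^ 2) set)"
    unfolding nikodym_set_def by blast
  then have "card ` {N :: ('a ^ 2) set. nikodym_set N} \<noteq> {}"
    by blast
  then have "nikodym_number TYPE('a) \<in> card ` {N :: ('a ^ 2) set. nikodym_set N}"
    unfolding nikodym_number_def by (intro Min_in) auto
  then obtain N :: "('a ^ 2) set"
    where N: "nikodym_set N" "nikodym_number TYPE('a) = card N"
    by blast
  obtain C :: "('a ^ 3) set set" where C: "minimal_blocking_set C" "card (- N) \<le> card C"
    using nikodym_complement_le_minimal_blocking_set[OF N(1)] .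
  have "card C \<le> max_minimal_blocking TYPE('a)"
    unfolding max_minimal_blocking_def using C(1) by (intro Max_ge) auto
  moreover have "card (- N) + card N = q ^ 2"
    using assms(2) card_mono[of UNIV N] by (simp add: Compl_eq_Diff_UNIV card_Diff_subset)
  ultimately show ?thesis
    using C(2) N(2) by linarith
qed

end
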